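(* Let $h>0$, $a\in\mathbb{R}$, $b=a+mh$ with $m\in\{2,3,\ldots\}$, let $0<\alpha\le 1$ and $f:\{a,a+h,\ldots,b\}\to\mathbb{R}$. Then $$\left({_h}\Delta_b^\alpha f\right)(t)=0\quad\text{for all } t\in\{a-(1-\alpha)h,\,a-(1-\alpha)h+h,\ldots,\,b-h-(1-\alpha)h\}$$ if and only if there is a constant $c\in\mathbb{R}$ such that $$f(t)=\frac{c}{\Gamma(\alpha)}\,(b-(1-\alpha)h-t)_h^{(\alpha-1)}\quad\text{for all } t\in\{a,a+h,\ldots,b\}.$$
   Context: For $h>0$ and $x,y\in\mathbb{R}$ the $h$-factorial function is $x_h^{(y)} = h^y\,\dfrac{\Gamma(\frac{x}{h}+1)}{\Gamma(\frac{x}{h}+1-y)}$, where $\Gamma$ is the Euler gamma function, with the convention that division at a pole yields zero. Put $\sigma_h(t)=t+h$ and $(\Delta_h g)(t)=\frac{g(t+h)-g(t)}{h}$. For $f:\{a,a+h,\ldots,b\}\to\mathbb{R}$ the right fractional $h$-sum of order $\nu>0$ is $$\left({_h}\Delta_b^{-\nu}f\right)(t)=\frac{1}{\Gamma(\nu)}\sum_{k=\frac{t}{h}+\nu}^{\frac{b}{h}}(kh-\sigma_h(t))_h^{(\nu-1)}f(kh)\,h,\quad t\in\{a-\nu h,a-\nu h+h,\ldots,b-\nu h\},$$ where $k$ runs in unit steps (limits not necessarily integers), and ${_h}\Delta_b^{0}f=f$. For $0<\alpha\le1$ and $\gamma=1-\alpha$, the right fractional $h$-difference of order $\alpha$ is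 $$\left({_h}\Delta_b^{\alpha}f\right)(t)=-\left(\Delta_h\,{_h}\Delta_b^{-\gamma}f\right)(t),\quad t\in\{a-\gamma h,a-\gamma h+h,\ldots,b-h-\gamma h\}.$$ *)

theory Defs
  imports "HOL-Analysis.Analysis"
begin

text \<open>
  The convention that division at a pole yields zero is built into the library:
  \<^term>\<open>Gamma\<close> is \<open>0\<close> at its poles (\<open>Gamma_eq_zero_iff\<close>) and \<open>x / 0 = 0\<close>.
\<close>

definition h_factorial :: "real \<Rightarrow> real \<Rightarrow> real \<Rightarrow> real" where
  "h_factorial h x y = h powr y * (Gamma (x / h + 1) / Gamma (x / h + 1 - y))"

definition h_shift :: "real \<Rightarrow> real \<Rightarrow> real" where
  "h_shift h t = t + h"

definition h_delta :: "real \<Rightarrow> (real \<Rightarrow> real) \<Rightarrow> real \<Rightarrow> real" where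
  "h_delta h g t = (g (t + h) - g t) / h"

definition unit_steps :: "real \<Rightarrow> real \<Rightarrow> real set" where
  "unit_steps p q = {p + real i | i :: nat. p + real i \<le> q}"

definition h_grid :: "real \<Rightarrow> real \<Rightarrow> real \<Rightarrow> real set" where
  "h_grid h p q = {p + real i * h | i :: nat. p + real i * h \<le> q}"

text \<open>
  A function on the grid \<open>h_grid h a b\<close> is represented by a function on all of \<^typ>\<open>real\<close>.
  For \<open>t \<in> h_grid h (a - \<nu> * h) (b - \<nu> * h)\<close>, where \<open>b\<close> is a point of \<open>h_grid h a b\<close>, the
  arguments \<open>k * h\<close> below all lie in \<open>h_grid h a b\<close>, so values of \<open>f\<close> off the grid are irrelevant.
  Only orders \<open>\<nu> \<ge> 0\<close> are meaningful.
\<close>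

definition right_h_sum :: "real \<Rightarrow> real \<Rightarrow> real \<Rightarrow> (real \<Rightarrow> real) \<Rightarrow> real \<Rightarrow> real" where
  "right_h_sum h b \<nu> f t =
     (if \<nu> = 0 then f t
      else 1 / Gamma \<nu> *
        (\<Sum>k \<in> unit_steps (t / h + \<nu>) (b / h).
           h_factorial h (k * h - h_shift h t) (\<nu> - 1) * f (k * h) * h))"

definition right_h_diff :: "real \<Rightarrow> real \<Rightarrow> real \<Rightarrow> (real \<Rightarrow> real) \<Rightarrow> real \<Rightarrow> real" where
  "right_h_diff h b \<alpha> f t = - h_delta h (right_h_sum h b (1 - \<alpha>) f) t"

end

theory Submission
  imports Defs
begin

text \<open>
  Read \<open>f\<close> backwards from \<open>b\<close>: with \<open>F n = f (b - n * h)\<close>, the \<open>h\<close>-sum of order \<open>\<gamma> = 1 - \<alpha>\<close> at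
  the grid point \<open>b - n * h - \<gamma> * h\<close> is \<open>h powr \<gamma>\<close> times the Cauchy product of \<open>F\<close> with
  \<open>pochhammer \<gamma> j / fact j\<close>, the coefficients of \<open>(1 - x) powr (-\<gamma>)\<close>. The difference vanishes iff
  this product is constant, i.e. has the generating function \<open>C / (1 - x)\<close> up to degree \<open>m\<close>. So
  \<open>F\<close> has the generating function \<open>C * (1 - x) powr (-\<alpha>)\<close>, whose coefficients are the claimed ones.
\<close>

definition rising_coeff :: "real \<Rightarrow> nat \<Rightarrow> real" where
  "rising_coeff x n = pochhammer x n / fact n"

lemma rising_coeff_0 [simp]: "rising_coeff x 0 = 1"
  by (simp add: rising_coeff_def)

lemma rising_coeff_zero: "rising_coeff 0 n = (if n = 0 then 1 else 0)"
  by (simp add: rising_coeff_def pochhammer_0_left)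

text \<open>The Chu-Vandermonde identity, divided by \<open>fact n\<close>: it compares coefficients
  in the product of two binomial series, whose exponents add.\<close>

lemma rising_coeff_convolution:
  "(\<Sum>j\<le>n. rising_coeff x j * rising_coeff y (n - j)) = rising_coeff (x + y) n"
  by (auto simp: rising_coeff_def pochhammer_binomial_sum binomial_fact sum_divide_distrib
      intro!: sum.cong)

lemma rising_coeff_complementary_convolution:
  assumes "x + y = 1"
  shows "(\<Sum>j\<le>n. rising_coeff x j * rising_coeff y (n - j)) = 1"
  using assms unfolding rising_coeff_convolution
  by (simp add: rising_coeff_def flip: pochhammer_fact)

lemma rising_coeff_Gamma:
  assumes "x > 0"
  shows "rising_coeff x n = Gamma (real n + x) / (Gamma x * Gamma (real n + 1))"
proof -
  have "x \<notin> \<int>\<^sub>\<le>\<^sub>0"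
    using assms by (auto elim!: nonpos_Ints_cases)
  then have "pochhammer x n = Gamma (x + real n) / Gamma x"
    by (rule pochhammer_Gamma)
  then show ?thesis
    by (simp add: rising_coeff_def Gamma_fact[symmetric] add.commute)
qed

text \<open>A power series with constant term 1 is invertible, here in truncated form: besides
  \<open>u n\<close>, the \<open>n\<close>-th product involves only earlier values of
  \<open>u\<close>, so strong induction applies.\<close>

lemma convolution_left_cancel:
  fixes w u v :: "nat \<Rightarrow> real"
  assumes "w 0 = 1"
    and eq: "\<And>n. n \<le> m \<Longrightarrow> (\<Sum>j\<le>n. w j * u (n - j)) = (\<Sum>j\<le>n. w j * v (n - j))"
    and "n \<le> m"
  shows "u n = v n"
  using \<open>n \<le> m\<close>
proof (induction n rule: less_induct)
  case (less n)
  have split: "(\<Sum>j\<le>n. w j * s (n - j)) = s n + (\<Sum>j\<in>{1..n}. w j * s (n - j))"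
    for s :: "nat \<Rightarrow> real"
    using \<open>w 0 = 1\<close> by (simp add: atMost_atLeast0 sum.atLeast_Suc_atMost)
  have "(\<Sum>j\<in>{1..n}. w j * u (n - j)) = (\<Sum>j\<in>{1..n}. w j * v (n - j))"
    using less by (intro sum.cong) auto
  then show ?case
    using eq[OF less.prems] split[of u] split[of v] by simp
qed

lemma constant_convolution_iff:
  fixes F :: "nat \<Rightarrow> real"
  assumes "x + y = 1"
  defines "K \<equiv> \<lambda>n. \<Sum>j\<le>n. rising_coeff x j * F (n - j)"
  shows "(\<forall>n<m. K n = K (Suc n)) \<longleftrightarrow> (\<exists>c. \<forall>n\<le>m. F n = c * rising_coeff y n)"
proof
  assume step: "\<forall>n<m. K n = K (Suc n)"
  \<comment> \<open>The constant is \<open>K 0 = F 0\<close>. The multiple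
    \<open>F 0 * rising_coeff y n\<close> has the same constant convolution, so cancelling
    \<open>rising_coeff x\<close> identifies it with \<open>F\<close>.\<close>
  have "K n = F 0" if "n \<le> m" for n
    using that
  proof (induction n)
    case (Suc n)
    then show ?case
      using step by (metis Suc_le_eq less_imp_le)
  qed (simp add: K_def)
  moreover have "(\<Sum>j\<le>n. rising_coeff x j * (F 0 * rising_coeff y (n - j))) = F 0" for n
    using rising_coeff_complementary_convolution[OF assms(1), of n]
    by (simp add: mult.left_commute flip: sum_distrib_left)
  ultimately have "F n = F 0 * rising_coeff y n" if "n \<le> m" for n
    using that
    by (intro convolution_left_cancel[of "rising_coeff x" m F "\<lambda>n. F 0 * rising_coeff y n"])
      (auto simp: K_def)
  then show "\<exists>c. \<forall>n\<le>m. F n = c * rising_coeff y n"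
    by blast
next
  assume "\<exists>c. \<forall>n\<le>m. F n = c * rising_coeff y n"
  then obtain c where c: "\<And>n. n \<le> m \<Longrightarrow> F n = c * rising_coeff y n"
    by blast
  have "K n = c" if "n \<le> m" for n
  proof -
    have "K n = (\<Sum>j\<le>n. c * (rising_coeff x j * rising_coeff y (n - j)))"
      unfolding K_def using that c by (intro sum.cong) auto
    then show ?thesis
      by (simp add: rising_coeff_complementary_convolution[OF assms(1)] flip: sum_distrib_left)
  qed
  then show "\<forall>n<m. K n = K (Suc n)"
    by simp
qed

lemma unit_steps_eq_image: "unit_steps p (p + real n) = (\<lambda>j. p + real j) ` {..n}"
  by (auto simp: unit_steps_def)

text \<open>Enumerates the grid downwards from its top, because the convolution index counts steps
  back from \<open>b\<close>.\<close>

lemma h_grid_eq_image: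
  assumes "h > 0" and "q = p + real n * h"
  shows "h_grid h p q = (\<lambda>i. q - real i * h) ` {..n}"
proof -
  have "h_grid h p q = (\<lambda>i. p + real i * h) ` {..n}"
    using assms by (auto simp: h_grid_def)
  also have "{..n} = (\<lambda>i. n - i) ` {..n}"
    by (rule endo_inj_surj[symmetric]) (auto simp: inj_on_def)
  also have "(\<lambda>i. p + real i * h) ` \<dots> = (\<lambda>i. p + real (n - i) * h) ` {..n}"
    by (rule image_image)
  also have "\<dots> = (\<lambda>i. q - real i * h) ` {..n}"
    using assms by (intro image_cong) (auto simp: of_nat_diff algebra_simps)
  finally show ?thesis .
qed

text \<open>The Gamma quotient becomes \<open>Gamma (n + x) / Gamma (n + 1)\<close>. Both arguments
  are positive or the sum of a natural number and \<open>x > 0\<close>, so no pole is met.\<close>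

lemma h_factorial_rising_coeff:
  assumes "h > 0" and "x > 0" and "s = (real n + x - 1) * h"
  shows "h_factorial h s (x - 1) = h powr (x - 1) * Gamma x * rising_coeff x n"
proof -
  have "s / h = real n + x - 1"
    using assms by simp
  moreover have "Gamma x \<noteq> 0"
    using Gamma_real_pos[OF \<open>x > 0\<close>] by simp
  ultimately show ?thesis
    using assms by (simp add: h_factorial_def rising_coeff_Gamma)
qed

lemma right_h_sum_eq_convolution:
  assumes "h > 0" and "\<gamma> \<ge> 0"
  shows "right_h_sum h b \<gamma> f (b - real n * h - \<gamma> * h)
    = h powr \<gamma> * (\<Sum>j\<le>n. rising_coeff \<gamma> j * f (b - real (n - j) * h))"
proof (cases "\<gamma> = 0")
  \<comment> \<open>Order 0 occurs for \<alpha> = 1. Here \<open>rising_coeff 0\<close> is the unit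
    of convolution, which agrees with the separate clause of \<open>right_h_sum\<close>.\<close>
  case True
  then show ?thesis
    using \<open>h > 0\<close> by (simp add: right_h_sum_def rising_coeff_zero if_distrib[of "\<lambda>x. x * _"] cong: if_cong)
next
  case False
  with assms have "\<gamma> > 0" by simp
  define t where "t = b - real n * h - \<gamma> * h"
  \<comment> \<open>The lower summation limit. It lies exactly \<open>n\<close> unit steps below
    \<open>b / h\<close>, so the sum has the terms \<open>j = 0, ..., n\<close>.\<close>
  define p where "p = t / h + \<gamma>"
  have p: "p * h = b - real n * h"
    using \<open>h > 0\<close> by (simp add: p_def t_def field_simps)
  then have bh: "b / h = p + real n"
    using \<open>h > 0\<close> by (simp add: field_simps)
  have Gamma: "Gamma \<gamma> \<noteq> 0"
    using Gamma_real_pos[OF \<open>\<gamma> > 0\<close>] by simp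
  have "(\<Sum>k\<in>unit_steps p (b / h). h_factorial h (k * h - h_shift h t) (\<gamma> - 1) * f (k * h) * h)
      = (\<Sum>j\<le>n. h_factorial h ((p + real j) * h - h_shift h t) (\<gamma> - 1) * f ((p + real j) * h) * h)"
    unfolding bh unit_steps_eq_image by (subst sum.reindex) (auto simp: inj_on_def)
  also have "\<dots> = (\<Sum>j\<le>n. Gamma \<gamma> * h powr \<gamma> * (rising_coeff \<gamma> j * f (b - real (n - j) * h)))"
  proof (rule sum.cong)
    fix j assume "j \<in> {..n}"
    have arg: "(p + real j) * h = b - real (n - j) * h"
      using p \<open>j \<in> {..n}\<close> by (simp add: of_nat_diff algebra_simps)
    have "(p + real j) * h - h_shift h t = (real j + \<gamma> - 1) * h"
      using p by (simp add: h_shift_def t_def algebra_simps)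
    then have "h_factorial h ((p + real j) * h - h_shift h t) (\<gamma> - 1)
        = h powr (\<gamma> - 1) * Gamma \<gamma> * rising_coeff \<gamma> j"
      by (rule h_factorial_rising_coeff[OF \<open>h > 0\<close> \<open>\<gamma> > 0\<close>])
    \<comment> \<open>The factor \<open>h\<close> at the end of each summand raises the exponent by
      one.\<close>
    moreover have "h powr \<gamma> = h powr (\<gamma> - 1) * h"
      using \<open>h > 0\<close> by (simp add: powr_diff)
    ultimately show "h_factorial h ((p + real j) * h - h_shift h t) (\<gamma> - 1) * f ((p + real j) * h) * h
        = Gamma \<gamma> * h powr \<gamma> * (rising_coeff \<gamma> j * f (b - real (n - j) * h))"
      unfolding arg by simp
  qed simp
  finally show ?thesis
    using False Gamma by (simp add: right_h_sum_def p_def t_def flip: sum_distrib_left)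
qed

theorem theorem13:
  fixes h a b \<alpha> :: real and m :: nat and f :: "real \<Rightarrow> real"
  assumes "h > 0"
    and "m \<ge> 2"
    and "b = a + real m * h"
    and "0 < \<alpha>" and "\<alpha> \<le> 1"
  shows "(\<forall>t \<in> h_grid h (a - (1 - \<alpha>) * h) (b - h - (1 - \<alpha>) * h). right_h_diff h b \<alpha> f t = 0)
    \<longleftrightarrow> (\<exists>c :: real. \<forall>t \<in> h_grid h a b.
           f t = c / Gamma \<alpha> * h_factorial h (b - (1 - \<alpha>) * h - t) (\<alpha> - 1))"
proof -
  define F where "F n = f (b - real n * h)" for n
  define K where "K n = (\<Sum>j\<le>n. rising_coeff (1 - \<alpha>) j * F (n - j))" for n
  define q where "q = b - h - (1 - \<alpha>) * h"
  have "q = a - (1 - \<alpha>) * h + real (m - 1) * h"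
    using assms by (simp add: q_def of_nat_diff algebra_simps)
  then have grid: "h_grid h (a - (1 - \<alpha>) * h) q = (\<lambda>n. q - real n * h) ` {..m - 1}"
    using \<open>h > 0\<close> by (rule h_grid_eq_image[rotated])
  have sum: "right_h_sum h b (1 - \<alpha>) f (b - real n * h - (1 - \<alpha>) * h) = h powr (1 - \<alpha>) * K n" for n
    using right_h_sum_eq_convolution[of h "1 - \<alpha>" b f n] assms by (simp add: K_def F_def)
  \<comment> \<open>Since \<open>q\<close> lies one step below the top of the grid of the sum, the
    difference at \<open>q - n * h\<close> compares index \<open>Suc n\<close> (at the point itself)
    with index \<open>n\<close> (one step up).\<close>
  have diff: "right_h_diff h b \<alpha> f (q - real n * h) = 0 \<longleftrightarrow> K n = K (Suc n)" for n
  proof -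
    have "q - real n * h + h = b - real n * h - (1 - \<alpha>) * h"
      by (simp add: q_def)
    moreover have "q - real n * h = b - real (Suc n) * h - (1 - \<alpha>) * h"
      by (simp add: q_def algebra_simps)
    ultimately have "right_h_diff h b \<alpha> f (q - real n * h)
        = - ((h powr (1 - \<alpha>) * K n - h powr (1 - \<alpha>) * K (Suc n)) / h)"
      unfolding right_h_diff_def h_delta_def by (metis sum)
    then show ?thesis
      using \<open>h > 0\<close> by simp
  qed
  have "(\<forall>t \<in> h_grid h (a - (1 - \<alpha>) * h) q. right_h_diff h b \<alpha> f t = 0) \<longleftrightarrow> (\<forall>n<m. K n = K (Suc n))"
    using \<open>m \<ge> 2\<close> by (auto simp: grid diff)
  also have "\<dots> \<longleftrightarrow> (\<exists>c. \<forall>n\<le>m. F n = c * rising_coeff \<alpha> n)"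
    unfolding K_def by (rule constant_convolution_iff) simp
  \<comment> \<open>Rescaling the constant by a nonzero power of \<open>h\<close> supplies the
    factor contained in \<open>h_factorial\<close>; its \<open>Gamma \<alpha>\<close> cancels
    against \<open>c / Gamma \<alpha>\<close> below.\<close>
  also have "\<dots> \<longleftrightarrow> (\<exists>c. \<forall>n\<le>m. F n = c * h powr (\<alpha> - 1) * rising_coeff \<alpha> n)"
  proof
    assume "\<exists>c. \<forall>n\<le>m. F n = c * rising_coeff \<alpha> n"
    then obtain c where "\<forall>n\<le>m. F n = c * rising_coeff \<alpha> n" ..
    then show "\<exists>c. \<forall>n\<le>m. F n = c * h powr (\<alpha> - 1) * rising_coeff \<alpha> n"
      using \<open>h > 0\<close> by (intro exI[of _ "c / h powr (\<alpha> - 1)"]) simp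
  qed blast
  also have "\<dots> \<longleftrightarrow> (\<exists>c. \<forall>t \<in> h_grid h a b.
      f t = c / Gamma \<alpha> * h_factorial h (b - (1 - \<alpha>) * h - t) (\<alpha> - 1))"
  proof -
    have "Gamma \<alpha> \<noteq> 0"
      using Gamma_real_pos[OF \<open>0 < \<alpha>\<close>] by simp
    moreover have "h_factorial h (b - (1 - \<alpha>) * h - (b - real n * h)) (\<alpha> - 1)
        = h powr (\<alpha> - 1) * Gamma \<alpha> * rising_coeff \<alpha> n" for n
      using assms by (intro h_factorial_rising_coeff) (auto simp: algebra_simps)
    ultimately show ?thesis
      by (simp add: h_grid_eq_image[OF \<open>h > 0\<close> assms(3)] F_def mult.assoc flip: atMost_iff Ball_def)
  qed
  finally show ?thesis
    unfolding q_def .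
qed

end
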